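(* Consider a point-to-multipoint storage system with finite I/O access bandwidth drives (drive blocking probability $P_b^D>0$). The leader-based scheduling scheme for uncoded storage (Algorithm U in the context) achieves maximal throughput across all service schemes for the uncoded data storage allocation, and the leader-based scheduling scheme for network coded storage (Algorithm C in the context) achieves maximal throughput across all service schemes for the coded data storage allocation.
   Context: **Storage.** A single file $\mathcal F=\{f_1,\dots,f_T\}$ of $T$ chunks is stored on drives $\mathcal D=\{D_1,\dots,D_R\}$. - Uncoded storage: drive $D_i$ holds a set $\mathcal M^f_i\subseteq\mathcal F$ of file chunks, with $\bigcup_{i=1}^R\mathcal M^f_i=\mathcal F$; $\mathcal M^d_j\subseteq\mathcal D$ is the set of drives holding $f_j$. - Coded storage: the drives hold $H$ coded chunks $c_1,\dots,c_H$, each $c_r=\sum_{j=1}^T\alpha_{j,r}f_j$ with coefficients in a finite field and encoding vector $\mathbf k_r=(\alpha_{1,r},\dots,\alpha_{T,r})$. The code is MDS: any $T$ of the encoding vectors are linearly independent. Each coded chunk is stored on one drive. **Drives.** In each timeslot $t$ each drive is blocked with probability $P_b^D$, independently across drives and timeslots. The availability vector $\bm b(t)\in\{0,1\}^R$ ($b_i(t)=0$: $D_i$ available; $b_i(t)=1$: $D_i$ blocked) is known to the server at the start of timeslot $t$. **Server and users.** In each timeslot the single server may read a single stored chunk from a single available drive, and at the end of the timeslot it broadcasts this chunk $x(t)$ without error to all active users. Each user requests the whole file and enters (if there is room in the server's buffer) having received nothing; the buffer is initially empty. The knowledge space $\mathbf K_m(t)$ of user $u_m$ is the matrix of encoding vectors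 it has received up to timeslot $t$ (an uncoded chunk $f_j$ has the unit encoding vector $\mathbf e_j$), and $r_m(t)=\operatorname{rank}\mathbf K_m(t)$. A user is active while it is in the buffer with $r_m(t)<T$ and departs when its rank becomes $T$. $\mathcal U_A$ denotes the set of currently active users. A user receives a new degree of freedom (d.o.f.) in timeslot $t$ if $r_m(t+1)=r_m(t)+1$. $\mathcal U_n(t)\subseteq\mathcal U_A$ is the set of targeted users, i.e. the active users that receive a new d.o.f. from the broadcast of $x(t)$. **Maximal throughput.** A scheduling service achieves maximal throughput if at each timeslot $t$ the number of targeted users $|\mathcal U_n(t)|$ is maximized across all service schemes for the given data storage allocation. Here the maximization at timeslot $t$ is greedy: it is over all choices of chunk that can be read in timeslot $t$ given the instantaneous drive availability $\bm b(t)$ and the current active users with their current knowledge spaces. **Algorithm U (uncoded).** For user $u_m$ let $a_{m,j}(t)=0$ if $u_m$ has decoded (received) $f_j$ and $a_{m,j}(t)=1$ otherwise. In each timeslot $t$: (1) obtain $\bm b(t)$; (2) set $\mathcal U_t=\mathcal U_A$; (3) let $u_\ell$ be the leader of $\mathcal U_t$, i.e. a user in $\mathcal U_t$ maximizing $r_m(t)$; (4) let $\mathcal F^u_\ell=\{f_j: a_{\ell,j}(t)=1\}$; (5) if at least one chunk of $\mathcal F^u_\ell$ is held by an available drive, select one such chunk $f_{j^*}$, read it from an available drive in $\mathcal M^d_{j^*}$, and broadcast $x(t)=f_{j^*}$ to all active users; otherwise remove $u_\ell$ from $\mathcal U_t$ and return to (3) (if $\mathcal U_t$ becomes empty, nothing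 useful is broadcast in this timeslot); (6) update $a_{m,j^*}=0$ for all active users. **Algorithm C (coded).** For user $u_m$ let $q_{m,r}(t)=0$ if $u_m$ has received coded chunk $c_r$ and $q_{m,r}(t)=1$ otherwise. In each timeslot $t$: (1) obtain $\bm b(t)$; (2) set $\mathcal U_t=\mathcal U_A$; (3) let $u_\ell$ be a user in $\mathcal U_t$ maximizing $r_m(t)$; (4) let $\mathcal C^u_\ell=\{c_r: q_{\ell,r}(t)=1\}$; (5) if at least one chunk of $\mathcal C^u_\ell$ is on an available drive, select one such chunk $c_{r^*}$, read it from its drive, and broadcast $x(t)=c_{r^*}$ to all active users; otherwise remove $u_\ell$ from $\mathcal U_t$ and return to (3) (if $\mathcal U_t$ becomes empty, nothing useful is broadcast); (6) update $q_{m,r^*}=0$ for all active users. *)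

theory Defs
  imports "HOL-Probability.Probability"
begin

section \<open>Storage\<close>

text \<open>
  File chunks are indexed by a finite type 't (so T = CARD('t)), drives by 'd (R = CARD('d)),
  stored chunks by 'c, and 'q is the finite coefficient field.  A storage allocation consists of an
  encoding vector for every stored chunk and a map assigning to each drive the set of stored chunks
  it holds.  In the uncoded case the stored chunks are the file chunks themselves ('c = 't).
\<close>

definition unit_encoding :: "'t \<Rightarrow> 'q::field ^ 't::finite"
  where "unit_encoding j = axis j 1"

definition uncoded_storage :: "('d \<Rightarrow> 't set) \<Rightarrow> bool"
  where "uncoded_storage Mf \<longleftrightarrow> (\<Union>i. Mf i) = UNIV"

text \<open>
  The first conjunct is H \<ge> T, implicit in speaking of an MDS code.  In the second one, injectivity
  makes linear independence that of the family (k r), r \<in> S, and not merely of its range.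
\<close>

definition mds_code :: "('c::finite \<Rightarrow> 'q::field ^ 't::finite) \<Rightarrow> bool"
  where "mds_code k \<longleftrightarrow> CARD('t) \<le> CARD('c) \<and>
    (\<forall>S. card S = CARD('t) \<longrightarrow> inj_on k S \<and> vec.independent (k ` S))"

text \<open>Every coded chunk is stored on exactly one drive, given by \<open>home\<close>.\<close>

definition coded_storage :: "('c \<Rightarrow> 'd) \<Rightarrow> 'd \<Rightarrow> 'c set"
  where "coded_storage home i = {r. home r = i}"

section \<open>Drive blocking\<close>

text \<open>\<open>b t i \<omega>\<close> holds iff drive \<open>i\<close> is blocked in timeslot \<open>t\<close>.\<close>

definition blocking_process :: "'w measure \<Rightarrow> real \<Rightarrow> (nat \<Rightarrow> 'd \<Rightarrow> 'w \<Rightarrow> bool) \<Rightarrow> bool"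
  where "blocking_process M P b \<longleftrightarrow> prob_space M \<and>
    prob_space.indep_vars M (\<lambda>_. count_space UNIV) (\<lambda>(t, i). b t i) UNIV \<and>
    (\<forall>t i. measure M {\<omega> \<in> space M. b t i \<omega>} = P)"

definition readable :: "('d \<Rightarrow> 'c set) \<Rightarrow> ('d \<Rightarrow> bool) \<Rightarrow> 'c set"
  where "readable store blocked = {c. \<exists>i. \<not> blocked i \<and> c \<in> store i}"

section \<open>Server and users\<close>

record ('u, 'c) state =
  buffer :: "'u set"
  received :: "'u \<Rightarrow> 'c set"

definition initial_state :: "('u, 'c) state"
  where "initial_state = \<lparr>buffer = {}, received = (\<lambda>_. {})\<rparr>"

text \<open>
  The rows of the knowledge matrix are the encoding vectors of the received chunks.  The row index
  type is fixed, so rows of chunks that were not received are set to 0, which does not affect the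
  rank.
\<close>

definition knowledge_matrix ::
    "('c::finite \<Rightarrow> 'q::field ^ 't::finite) \<Rightarrow> ('u, 'c) state \<Rightarrow> 'u \<Rightarrow> 'q ^ 't ^ 'c"
  where "knowledge_matrix enc s u = (\<chi> r. if r \<in> received s u then enc r else 0)"

definition user_rank ::
    "('c::finite \<Rightarrow> 'q::field ^ 't::finite) \<Rightarrow> ('u, 'c) state \<Rightarrow> 'u \<Rightarrow> nat"
  where "user_rank enc s u = rank (knowledge_matrix enc s u)"

definition active ::
    "('c::finite \<Rightarrow> 'q::field ^ 't::finite) \<Rightarrow> ('u, 'c) state \<Rightarrow> 'u set"
  where "active enc s = {u \<in> buffer s. user_rank enc s u < CARD('t)}"

definition admit :: "'u set \<Rightarrow> ('u, 'c) state \<Rightarrow> ('u, 'c) state"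
  where "admit E s = \<lparr>buffer = buffer s \<union> E,
                      received = (\<lambda>u. if u \<in> E then {} else received s u)\<rparr>"

text \<open>The decision \<open>None\<close> stands for a timeslot without a broadcast.\<close>

definition broadcast ::
    "('c::finite \<Rightarrow> 'q::field ^ 't::finite) \<Rightarrow> 'c option \<Rightarrow> ('u, 'c) state \<Rightarrow> ('u, 'c) state"
  where "broadcast enc x s = s\<lparr>received :=
    (\<lambda>u. if u \<in> active enc s then received s u \<union> set_option x else received s u)\<rparr>"

definition depart ::
    "('c::finite \<Rightarrow> 'q::field ^ 't::finite) \<Rightarrow> ('u, 'c) state \<Rightarrow> ('u, 'c) state"
  where "depart enc s = s\<lparr>buffer := active enc s\<rparr>"

definition targeted ::
    "('c::finite \<Rightarrow> 'q::field ^ 't::finite) \<Rightarrow> ('u, 'c) state \<Rightarrow> 'c option \<Rightarrow> 'u set"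
  where "targeted enc s x =
    {u \<in> active enc s. user_rank enc (broadcast enc x s) u = user_rank enc s u + 1}"

section \<open>Service schemes and maximal throughput\<close>

text \<open>
  A scheme relates the availability vector and the current state to the decisions it may take;
  it is a relation because ties (between leaders, between chunks) are broken arbitrarily.
\<close>

type_synonym ('u, 'c, 'd) scheme = "('d \<Rightarrow> bool) \<Rightarrow> ('u, 'c) state \<Rightarrow> 'c option \<Rightarrow> bool"

text \<open>
  \<open>reachable enc B \<beta> \<sigma> t s\<close>: running scheme \<open>\<sigma>\<close> from the empty buffer under the blocking
  realization \<open>\<beta>\<close> can lead to state \<open>s\<close> in timeslot \<open>t\<close> when the server takes its decision.
  At the start of each timeslot an arbitrary set \<open>E\<close> of users that fits into the buffer of size
  \<open>B\<close> enters, so that every arrival pattern is covered.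
\<close>

definition entering :: "nat \<Rightarrow> ('u, 'c) state \<Rightarrow> 'u set \<Rightarrow> bool"
  where "entering B s E \<longleftrightarrow> finite E \<and> E \<inter> buffer s = {} \<and> card (buffer s \<union> E) \<le> B"

inductive reachable ::
    "('c::finite \<Rightarrow> 'q::field ^ 't::finite) \<Rightarrow> nat \<Rightarrow> (nat \<Rightarrow> 'd \<Rightarrow> bool) \<Rightarrow>
      ('u, 'c, 'd) scheme \<Rightarrow> nat \<Rightarrow> ('u, 'c) state \<Rightarrow> bool"
  for enc B \<beta> \<sigma>
  where
    start: "reachable enc B \<beta> \<sigma> 0 (admit E s0)"
      if "s0 = initial_state" and "entering B s0 E"
  | step: "reachable enc B \<beta> \<sigma> (Suc t) (admit E s')"
      if "reachable enc B \<beta> \<sigma> t s" and "\<sigma> (\<beta> t) s x"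
        and "s' = depart enc (broadcast enc x s)" and "entering B s' E"

definition maximal_decision ::
    "('c::finite \<Rightarrow> 'q::field ^ 't::finite) \<Rightarrow> ('d \<Rightarrow> 'c set) \<Rightarrow> ('d \<Rightarrow> bool) \<Rightarrow>
      ('u, 'c) state \<Rightarrow> 'c option \<Rightarrow> bool"
  where "maximal_decision enc store blocked s x \<longleftrightarrow>
    is_arg_max (\<lambda>y. card (targeted enc s y)) (\<lambda>y. set_option y \<subseteq> readable store blocked) x"

text \<open>
  The existence part excludes a scheme that gets stuck, for which the second part would hold
  vacuously.
\<close>

definition achieves_maximal_throughput ::
    "('c::finite \<Rightarrow> 'q::field ^ 't::finite) \<Rightarrow> ('d \<Rightarrow> 'c set) \<Rightarrow> nat \<Rightarrow>
      (nat \<Rightarrow> 'd \<Rightarrow> bool) \<Rightarrow> ('u, 'c, 'd) scheme \<Rightarrow> bool"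
  where "achieves_maximal_throughput enc store B \<beta> \<sigma> \<longleftrightarrow>
    (\<forall>t s. reachable enc B \<beta> \<sigma> t s \<longrightarrow>
      (\<exists>x. \<sigma> (\<beta> t) s x) \<and>
      (\<forall>x. \<sigma> (\<beta> t) s x \<longrightarrow> maximal_decision enc store (\<beta> t) s x))"

section \<open>Leader-based scheduling\<close>

text \<open>
  \<open>leader_search enc store blocked s U x\<close>: the search for a leader that can be served, started
  with candidate set \<open>U\<close>, may end with decision \<open>x\<close>.  The chunks missing at user \<open>l\<close>
  (flag 1 in the algorithms) are those outside \<open>received s l\<close>; broadcasting updates the flags of
  all active users.
\<close>

inductive leader_search ::
    "('c::finite \<Rightarrow> 'q::field ^ 't::finite) \<Rightarrow> ('d \<Rightarrow> 'c set) \<Rightarrow> ('d \<Rightarrow> bool) \<Rightarrow>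
      ('u, 'c) state \<Rightarrow> 'u set \<Rightarrow> 'c option \<Rightarrow> bool"
  for enc store blocked s
  where
    serve: "leader_search enc store blocked s U (Some c)"
      if "is_arg_max (user_rank enc s) (\<lambda>u. u \<in> U) l"
        and "c \<in> - received s l \<inter> readable store blocked"
  | skip: "leader_search enc store blocked s U x"
      if "is_arg_max (user_rank enc s) (\<lambda>u. u \<in> U) l"
        and "- received s l \<inter> readable store blocked = {}"
        and "leader_search enc store blocked s (U - {l}) x"
  | idle: "leader_search enc store blocked s {} None"

text \<open>
  Algorithms U and C differ only in the allocation they are run on: for U the stored chunks are the
  file chunks with \<open>unit_encoding\<close>, for C they are the coded chunks.
\<close>

definition leader_scheme ::
    "('c::finite \<Rightarrow> 'q::field ^ 't::finite) \<Rightarrow> ('d \<Rightarrow> 'c set) \<Rightarrow> ('u, 'c, 'd) scheme"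
  where "leader_scheme enc store blocked s x \<longleftrightarrow>
    leader_search enc store blocked s (active enc s) x"

end

theory Submission
  imports Defs
begin

text \<open>
  Every broadcast reaches all active users, so the sets of chunks received by the active users form a
  chain.  By the MDS property every missing chunk is innovative to an active user, so the rank of a
  user is the number of its received chunks, and a leader has received everything that the other
  candidates have received.  Hence a chunk missing at the leader serves all remaining candidates, while
  the users skipped before cannot be served by any readable chunk.  The unit encoding is itself MDS, so
  the same argument covers uncoded storage.
\<close>

text \<open>The only set of \<open>CARD('t)\<close> file chunks is \<open>UNIV\<close>, whose
  encoding vectors form the standard basis.\<close>

lemma mds_code_unit_encoding: "mds_code (unit_encoding :: 't::finite \<Rightarrow> 'q::field ^ 't)"
  unfolding mds_code_def
proof (intro conjI allI impI)
  fix S :: "'t set"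
  assume "card S = CARD('t)"
  then have S: "S = UNIV"
    by (simp add: card_eq_UNIV_imp_eq_UNIV)
  show "inj_on (unit_encoding :: 't \<Rightarrow> 'q ^ 't) S"
    by (auto simp: inj_on_def unit_encoding_def axis_eq_axis)
  have "unit_encoding ` S = (cart_basis :: ('q ^ 't) set)"
    by (auto simp: S unit_encoding_def cart_basis_def)
  then show "vec.independent ((unit_encoding :: 't \<Rightarrow> 'q ^ 't) ` S)"
    by (simp add: independent_cart_basis)
qed simp

text \<open>\<open>mds_code\<close> speaks only of sets of exactly \<open>CARD('t)\<close> chunks. A
  smaller set extends to such a set, because at least \<open>CARD('t)\<close> chunks exist; a larger
  one contains such a set and so already has full dimension.\<close>

lemma mds_code_dim:
  fixes k :: "'c::finite \<Rightarrow> 'q::field ^ 't::finite"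
  assumes "mds_code k"
  shows "vec.dim (k ` S) = min (card S) CARD('t)"
proof (cases "card S \<le> CARD('t)")
  case True
  have "CARD('t) - card S \<le> card (- S)"
    using assms card_Diff_subset[of S UNIV]
    by (simp add: mds_code_def diff_le_mono flip: Compl_eq_Diff_UNIV)
  then obtain R where R: "R \<subseteq> - S" "card R = CARD('t) - card S"
    by (meson obtain_subset_with_card_n)
  then have "card (S \<union> R) = CARD('t)"
    using True by (subst card_Un_disjoint) auto
  then have "inj_on k (S \<union> R)" "vec.independent (k ` (S \<union> R))"
    using assms by (auto simp: mds_code_def)
  then have "inj_on k S" "vec.independent (k ` S)"
    using vec.independent_mono[of "k ` (S \<union> R)" "k ` S"] by (auto intro: inj_on_subset)
  then show ?thesis
    using True by (simp add: vec.dim_eq_card_independent card_image)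
next
  case False
  then obtain R where R: "R \<subseteq> S" "card R = CARD('t)"
    by (metis nle_le obtain_subset_with_card_n)
  then have "inj_on k R" "vec.independent (k ` R)"
    using assms by (auto simp: mds_code_def)
  then have "vec.dim (k ` R) = CARD('t)"
    using R by (simp add: vec.dim_eq_card_independent card_image)
  moreover have "vec.dim (k ` R) \<le> vec.dim (k ` S)"
    using R by (intro vec.dim_subset image_mono)
  moreover have "vec.dim (k ` S) \<le> CARD('t)"
    using vec.dim_subset_UNIV[of "k ` S"] by (simp add: vec.dimension_def card_cart_basis)
  ultimately show ?thesis
    using False by simp
qed

text \<open>The zero rows standing for missing chunks leave the row space unchanged.\<close>

lemma user_rank_eq_dim: "user_rank enc s u = vec.dim (enc ` received s u)"
proof -
  let ?A = "knowledge_matrix enc s u" and ?K = "enc ` received s u"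
  have row: "row i ?A = (if i \<in> received s u then enc i else 0)" for i
    by (simp add: row_def knowledge_matrix_def vec_eq_iff)
  have "?K \<subseteq> rows ?A"
    by (force simp: rows_def row)
  moreover have "rows ?A \<subseteq> vec.span ?K"
    by (auto simp: rows_def row vec.span_zero intro: vec.span_base)
  ultimately have "vec.dim ?K \<le> vec.dim (rows ?A)" "vec.dim (rows ?A) \<le> vec.dim ?K"
    using vec.dim_subset[of "rows ?A" "vec.span ?K"] by (auto intro: vec.dim_subset)
  then show ?thesis
    by (simp add: user_rank_def row_rank_def_gen)
qed

text \<open>A broadcast alters nothing for inactive users, so none of them can become
  active.\<close>

lemma active_broadcast_subset: "active enc (broadcast enc x s) \<subseteq> active enc s"
proof
  fix u
  assume u: "u \<in> active enc (broadcast enc x s)"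
  show "u \<in> active enc s"
  proof (rule ccontr)
    assume "u \<notin> active enc s"
    moreover from this have "user_rank enc (broadcast enc x s) u = user_rank enc s u"
      by (simp add: user_rank_eq_dim broadcast_def)
    ultimately show False
      using u by (simp add: active_def broadcast_def)
  qed
qed

lemma active_admit_subset: "active enc (admit E s) \<subseteq> buffer s \<union> E"
  by (auto simp: active_def admit_def)

lemma received_admit: "received (admit E s) u = (if u \<in> E then {} else received s u)"
  by (simp add: admit_def)

text \<open>As \<open>card\<close> of an infinite set is 0, the bound in \<open>entering\<close>
  alone does not exclude an infinite buffer; finiteness comes from adding a finite \<open>E\<close>
  in each timeslot.\<close>

lemma reachable_finite_buffer: "reachable enc B \<beta> \<sigma> t s \<Longrightarrow> finite (buffer s)"
proof (induction rule: reachable.induct)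
  case (start s0 E)
  then show ?case
    by (simp add: admit_def initial_state_def entering_def)
next
  case (step t s x s' E)
  have "active enc (broadcast enc x s) \<subseteq> buffer s"
    by (auto simp: active_def broadcast_def)
  with step show ?case
    by (auto simp: admit_def depart_def entering_def intro: finite_subset)
qed

lemma reachable_received_chain:
  assumes "reachable enc B \<beta> \<sigma> t s" "u \<in> active enc s" "v \<in> active enc s"
  shows "received s u \<subseteq> received s v \<or> received s v \<subseteq> received s u"
  using assms
proof (induction arbitrary: u v rule: reachable.induct)
  case (start s0 E)
  then show ?case
    using active_admit_subset[of enc E s0] by (auto simp: received_admit initial_state_def)
next
  case (step t s x s' E)
  show ?case
  \<comment> \<open>A user that has just entered has received nothing, so its set is comparable to
    every other.\<close>
  proof (cases "u \<in> E \<or> v \<in> E")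
    case True
    then show ?thesis
      by (auto simp: received_admit)
  next
    case False
    \<comment> \<open>Whoever stays after the departures was active during the broadcast, so both
      users gained the same \<open>set_option x\<close>, which preserves inclusion.\<close>
    have "buffer s' \<subseteq> active enc s"
      using active_broadcast_subset[of enc x s] by (simp add: step.hyps depart_def)
    then have act: "u \<in> active enc s" "v \<in> active enc s"
      using False step.prems active_admit_subset[of enc E s'] by auto
    then have "received s' u = received s u \<union> set_option x"
      "received s' v = received s v \<union> set_option x"
      by (simp_all add: step.hyps depart_def broadcast_def)
    with False step.IH[OF act] show ?thesis
      by (auto simp: received_admit)
  qed
qed

lemma mds_code_user_rank:
  fixes k :: "'c::finite \<Rightarrow> 'q::field ^ 't::finite"
  assumes "mds_code k"
  shows "user_rank k s u = min (card (received s u)) CARD('t)"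
  by (simp add: user_rank_eq_dim mds_code_dim[OF assms])

lemma mds_code_active_rank:
  fixes k :: "'c::finite \<Rightarrow> 'q::field ^ 't::finite"
  assumes "mds_code k" "u \<in> active k s"
  shows "user_rank k s u = card (received s u)" "card (received s u) < CARD('t)"
  using assms(2) by (auto simp: active_def mds_code_user_rank[OF assms(1)])

lemma targeted_None: "targeted enc s None = {}"
  by (simp add: targeted_def broadcast_def user_rank_eq_dim)

text \<open>An active user holds fewer than \<open>CARD('t)\<close> chunks, so one further chunk
  still raises the minimum that equals its rank.\<close>

lemma mds_code_targeted_Some:
  fixes k :: "'c::finite \<Rightarrow> 'q::field ^ 't::finite"
  assumes "mds_code k"
  shows "targeted k s (Some c) = {u \<in> active k s. c \<notin> received s u}"
proof -
  have "user_rank k (broadcast k (Some c) s) u = user_rank k s u + 1 \<longleftrightarrow> c \<notin> received s u"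
    if u: "u \<in> active k s" for u
    using mds_code_active_rank[OF assms u] u
    by (cases "c \<in> received s u")
      (simp_all add: mds_code_user_rank[OF assms] broadcast_def insert_absorb)
  then show ?thesis
    by (auto simp: targeted_def)
qed

text \<open>Every skip shrinks the finite candidate set, and a nonempty finite set has a
  leader.\<close>

lemma leader_search_total: "finite U \<Longrightarrow> \<exists>x. leader_search enc store blocked s U x"
proof (induction "card U" arbitrary: U)
  case 0
  then show ?case
    by (auto intro: leader_search.idle)
next
  case (Suc n)
  then have "U \<noteq> {}"
    by auto
  with Suc.prems obtain l where l: "is_arg_max (user_rank enc s) (\<lambda>u. u \<in> U) l"
    using Max_in[of "user_rank enc s ` U"] Max_ge[of "user_rank enc s ` U"]
    by (fastforce simp: is_arg_max_linorder)
  then have "n = card (U - {l})"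
    using Suc by (simp add: is_arg_max_def)
  with Suc l show ?case
    by (metis leader_search.serve leader_search.skip all_not_in_conv finite_Diff)
qed

text \<open>The last assumption is the invariant of the search: a user already removed from
  \<open>U\<close> misses no readable chunk.\<close>

lemma leader_search_maximal:
  fixes k :: "'c::finite \<Rightarrow> 'q::field ^ 't::finite"
  assumes mds: "mds_code k"
    and fin: "finite (active k s)"
    and chain: "\<And>u v. u \<in> active k s \<Longrightarrow> v \<in> active k s \<Longrightarrow>
      received s u \<subseteq> received s v \<or> received s v \<subseteq> received s u"
    and search: "leader_search k store blocked s U x"
    and "U \<subseteq> active k s"
    and "\<And>u. u \<in> active k s - U \<Longrightarrow> - received s u \<inter> readable store blocked = {}"
  shows "maximal_decision k store blocked s x"
proof -
  \<comment> \<open>Inclusion of the targeted sets is stronger than the comparison of their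
    cardinalities.\<close>
  have "set_option x \<subseteq> readable store blocked \<and>
      (\<forall>y. set_option y \<subseteq> readable store blocked \<longrightarrow> targeted k s y \<subseteq> targeted k s x)"
    using search assms(5,6)
  proof (induction rule: leader_search.induct)
    case (serve U l c)
    have l: "l \<in> active k s"
      using serve by (auto simp: is_arg_max_def)
    have "received s u \<subseteq> received s l" if u: "u \<in> U" for u
    proof -
      have act: "u \<in> active k s"
        using u serve.prems by blast
      have "user_rank k s u \<le> user_rank k s l"
        using u serve.hyps by (simp add: is_arg_max_linorder)
      then have "card (received s u) \<le> card (received s l)"
        by (simp add: mds_code_active_rank(1)[OF mds] act l)
      then show ?thesis
        \<comment> \<open>Within a chain of finite sets, the order by cardinality is the order by
          inclusion.\<close>
        using chain[OF act l] card_seteq[OF finite, of "received s l" "received s u"] by blast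
    qed
    then have "U \<subseteq> targeted k s (Some c)"
      using serve by (auto simp: mds_code_targeted_Some[OF mds])
    \<comment> \<open>By the invariant, no readable chunk is new to an active user outside
      \<open>U\<close>.\<close>
    moreover have "targeted k s y \<subseteq> U" if "set_option y \<subseteq> readable store blocked" for y
      using that serve.prems(2)
      by (cases y) (auto simp: targeted_None mds_code_targeted_Some[OF mds])
    moreover have "set_option (Some c) \<subseteq> readable store blocked"
      using serve.hyps by simp
    ultimately show ?case
      by blast
  next
    \<comment> \<open>The skipped leader misses no readable chunk, so the invariant passes to
      \<open>U - {l}\<close>.\<close>
    case (skip U l x)
    then show ?case
      by blast
  next
    case idle
    have "targeted k s y = {}" if "set_option y \<subseteq> readable store blocked" for y
      using that idle.prems(2)
      by (cases y) (auto simp: targeted_None mds_code_targeted_Some[OF mds])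
    then show ?case
      by auto
  qed
  moreover have "finite (targeted k s x)"
    using fin by (simp add: targeted_def)
  ultimately show ?thesis
    by (auto simp: maximal_decision_def is_arg_max_linorder intro: card_mono)
qed

lemma leader_scheme_achieves_maximal_throughput:
  fixes k :: "'c::finite \<Rightarrow> 'q::field ^ 't::finite"
  assumes "mds_code k"
  shows "achieves_maximal_throughput k store B \<beta> (leader_scheme k store :: ('u, 'c, 'd) scheme)"
  unfolding achieves_maximal_throughput_def leader_scheme_def
proof (intro allI impI)
  fix t and s :: "('u, 'c) state"
  assume reach: "reachable k B \<beta> (\<lambda>blocked s. leader_search k store blocked s (active k s)) t s"
  then have fin: "finite (active k s)"
    using reachable_finite_buffer[OF reach] by (simp add: active_def)
  show "(\<exists>x. leader_search k store (\<beta> t) s (active k s) x) \<and>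
      (\<forall>x. leader_search k store (\<beta> t) s (active k s) x \<longrightarrow>
        maximal_decision k store (\<beta> t) s x)"
    \<comment> \<open>The search starts with all active users, where the invariant holds
      vacuously.\<close>
    using leader_search_total[OF fin]
      leader_search_maximal[OF assms fin reachable_received_chain[OF reach]]
    by blast
qed

theorem lemma4:
  fixes M :: "'w measure"
    and P :: real
    and b :: "nat \<Rightarrow> 'd::finite \<Rightarrow> 'w \<Rightarrow> bool"
    and B :: nat
  assumes "blocking_process M P b" and "P > 0"
  shows "(\<forall>Mf :: 'd \<Rightarrow> 't::finite set. uncoded_storage Mf \<longrightarrow>
      (\<forall>\<omega>\<in>space M.
        achieves_maximal_throughput (unit_encoding :: 't \<Rightarrow> 'q::{field, finite} ^ 't) Mf B
          (\<lambda>t i. b t i \<omega>)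
          (leader_scheme (unit_encoding :: 't \<Rightarrow> 'q ^ 't) Mf :: ('u, 't, 'd) scheme)))
    \<and>
    (\<forall>(k :: 'c::finite \<Rightarrow> 'q ^ 't) (home :: 'c \<Rightarrow> 'd). mds_code k \<longrightarrow>
      (\<forall>\<omega>\<in>space M.
        achieves_maximal_throughput k (coded_storage home) B
          (\<lambda>t i. b t i \<omega>)
          (leader_scheme k (coded_storage home) :: ('u, 'c, 'd) scheme)))"
  by (intro conjI allI impI ballI leader_scheme_achieves_maximal_throughput mds_code_unit_encoding)

end
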